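(* Let $D$ be a right-convex divergence on $\mathcal{P}$ such that, for all $P,Q\in\mathcal{P}$, with $R(t)=(Q-P)t+P$, the function $t\mapsto \frac{1}{t}D(P\|R(t))$ is integrable on $[0,1]$ (Lebesgue measure). Then $\Psi[D]$ is also a right-convex divergence, and for all $P,Q\in\mathcal{P}$ and all $t\in[0,1]$, $$D(P\|R(t))\geq \Psi[D](P\|R(t))\geq 0 .$$ If $P\neq Q$, then $t\mapsto\Psi[D](P\|R(t))$ is strictly increasing on $[0,1]$. Furthermore, $t\mapsto\frac{1}{t}\Psi[D](P\|R(t))$ is integrable on $[0,1]$.
   Context: $(\Sigma,\mathcal{M})$ is a measurable space and $\mathcal{P}$ is the set of probability distributions (measures) on it with common support. A divergence is a function $D:\mathcal{P}\times\mathcal{P}\to[0,\infty]$ such that, for all $P,Q\in\mathcal{P}$, $D(P\|Q)\ge 0$, and $D(P\|Q)=0$ if and only if $P=Q$. It is right-convex if it is convex in the second argument: $\lambda D(P\|Q_1)+(1-\lambda)D(P\|Q_2)\ge D(P\|\lambda Q_1+(1-\lambda)Q_2)$ for all $P,Q_1,Q_2\in\mathcal{P}$ and $\lambda\in[0,1]$. For $P,Q\in\mathcal{P}$ and $t\in[0,1]$, $R(t):=(Q-P)t+P\in\mathcal{P}$ denotes the mixture distribution. Integral operator: when $\frac1t D(P\|R(t))$ is integrable on $[0,1]$, define $\Psi[D](P\|R(t)):=\int_0^t\frac1s D(P\|R(s))\,ds$. The right-hand side depends only on $P$ and the distribution $R(t)$, so $\Psi[D]$ is a well-defined function on $\mathcal{P}\times\mathcal{P}$;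 equivalently, $\Psi[D](P\|Q)=\int_0^1\frac1s D(P\|(Q-P)s+P)\,ds$. *)

theory Defs
  imports "HOL-Probability.Probability"
begin

text \<open>
  The measurable space is the one underlying \<^term>\<open>N\<close>. On a general measurable space the support of
  a distribution is only meaningful up to null sets, so that two distributions have the same
  support iff they are mutually absolutely continuous, i.e. have the same null sets. The role of
  \<^term>\<open>N\<close> is only to supply the measurable space and the common null sets; nothing else is
  required of it.
\<close>

definition distributions :: "'a measure \<Rightarrow> 'a measure set" where
  "distributions N = {P. prob_space P \<and> sets P = sets N \<and> null_sets P = null_sets N}"

text \<open>
  The distribution \<open>(Q - P) t + P = (1 - t) P + t Q\<close>. It is a measure only for
  \<open>0 \<le> t \<le> 1\<close>. Note the order of the arguments: the weight \<^term>\<open>t\<close> belongs to \<^term>\<open>Q\<close>.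
\<close>

definition mixture :: "'a measure \<Rightarrow> 'a measure \<Rightarrow> real \<Rightarrow> 'a measure" where
  "mixture P Q t = measure_of (space P) (sets P)
     (\<lambda>A. ennreal (1 - t) * emeasure P A + ennreal t * emeasure Q A)"

lemma sets_mixture [simp]: "sets (mixture P Q t) = sets P"
  by (simp add: mixture_def)

lemma space_mixture [simp]: "space (mixture P Q t) = space P"
  by (simp add: mixture_def)

lemma emeasure_mixture:
  assumes "sets Q = sets P"
  shows "emeasure (mixture P Q t) A
    = ennreal (1 - t) * emeasure P A + ennreal t * emeasure Q A"
proof (cases "A \<in> sets P")
  case True
  show ?thesis
    unfolding mixture_def
  proof (rule emeasure_measure_of_sigma)
    show "sigma_algebra (space P) (sets P)"
      by (rule sets.sigma_algebra_axioms)
    show "positive (sets P)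
        (\<lambda>A. ennreal (1 - t) * emeasure P A + ennreal t * emeasure Q A)"
      by (simp add: positive_def)
    show "countably_additive (sets P)
        (\<lambda>A. ennreal (1 - t) * emeasure P A + ennreal t * emeasure Q A)"
      using assms by (auto simp: countably_additive_def suminf_emeasure simp flip: suminf_add)
    show "A \<in> sets P" by fact
  qed
next
  case False
  then show ?thesis
    using assms by (simp add: emeasure_notin_sets)
qed

lemma mixture_in_distributions:
  assumes P: "P \<in> distributions N" and Q: "Q \<in> distributions N" and t: "t \<in> {0..1}"
  shows "mixture P Q t \<in> distributions N"
proof -
  interpret P: prob_space P using P by (simp add: distributions_def)
  interpret Q: prob_space Q using Q by (simp add: distributions_def)
  have sets: "sets P = sets N" "sets Q = sets N" "sets Q = sets P"
    and null: "null_sets P = null_sets N" "null_sets Q = null_sets N"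
    using P Q by (simp_all add: distributions_def)
  have sp: "space Q = space P" using sets(3) by (rule sets_eq_imp_space_eq)
  have "emeasure (mixture P Q t) (space P) = 1"
    using t Q.emeasure_space_1
    by (simp add: emeasure_mixture sets(3) P.emeasure_space_1 sp flip: ennreal_plus)
  then have "prob_space (mixture P Q t)" by (intro prob_spaceI) simp
  moreover have "A \<in> null_sets (mixture P Q t) \<longleftrightarrow> A \<in> null_sets N" for A
  proof (cases "A \<in> sets N")
    case True
    then have "emeasure P A = 0 \<longleftrightarrow> emeasure N A = 0" "emeasure Q A = 0 \<longleftrightarrow> emeasure N A = 0"
      using null sets by (metis null_setsD1 null_setsI)+
    then show ?thesis
      using True t by (auto simp: null_sets_def sets emeasure_mixture ennreal_eq_0_iff)
  qed (auto simp: null_sets_def sets)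
  ultimately show ?thesis using sets by (auto simp: distributions_def)
qed

definition divergence :: "'a measure set \<Rightarrow> ('a measure \<Rightarrow> 'a measure \<Rightarrow> ennreal) \<Rightarrow> bool" where
  "divergence \<P> D \<longleftrightarrow> (\<forall>P\<in>\<P>. \<forall>Q\<in>\<P>. D P Q \<ge> 0 \<and> (D P Q = 0 \<longleftrightarrow> P = Q))"

definition right_convex :: "'a measure set \<Rightarrow> ('a measure \<Rightarrow> 'a measure \<Rightarrow> ennreal) \<Rightarrow> bool" where
  "right_convex \<P> D \<longleftrightarrow> (\<forall>P\<in>\<P>. \<forall>Q1\<in>\<P>. \<forall>Q2\<in>\<P>. \<forall>l\<in>{0..1::real}.
     ennreal l * D P Q1 + ennreal (1 - l) * D P Q2 \<ge> D P (mixture Q2 Q1 l))"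

text \<open>Lebesgue integrability on \<open>[0,1]\<close> of a function with values in \<open>[0,\<infinity>]\<close>.\<close>

definition integrable_unit :: "(real \<Rightarrow> ennreal) \<Rightarrow> bool" where
  "integrable_unit f \<longleftrightarrow>
     f \<in> borel_measurable (lebesgue_on {0..1}) \<and> (\<integral>\<^sup>+t. f t \<partial>lebesgue_on {0..1}) < \<infinity>"

definition Psi :: "('a measure \<Rightarrow> 'a measure \<Rightarrow> ennreal) \<Rightarrow> 'a measure \<Rightarrow> 'a measure \<Rightarrow> ennreal" where
  "Psi D P Q = (\<integral>\<^sup>+s. ennreal (1 / s) * D P (mixture P Q s) \<partial>lebesgue_on {0..1})"

lemma mixture_mixture:
  assumes "sets Q = sets P" "s \<in> {0..1}" "t \<in> {0..1}"
  shows "mixture P (mixture P Q t) s = mixture P Q (t * s)"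
proof (rule measure_eqI)
  fix A
  have "ennreal (1 - s) + ennreal s * ennreal (1 - t) = ennreal (1 - t * s)"
  proof -
    have "ennreal (1 - s) + ennreal s * ennreal (1 - t) = ennreal (1 - s + s * (1 - t))"
      using assms by (simp add: ennreal_mult ennreal_plus)
    also have "1 - s + s * (1 - t) = 1 - t * s"
      by (simp add: algebra_simps)
    finally show ?thesis .
  qed
  moreover have "ennreal s * ennreal t = ennreal (t * s)"
    using assms by (simp add: mult.commute flip: ennreal_mult)
  ultimately show "emeasure (mixture P (mixture P Q t) s) A = emeasure (mixture P Q (t * s)) A"
    using assms(1)
    by (simp add: emeasure_mixture distrib_left mult.assoc [symmetric])
       (simp add: distrib_right add.assoc [symmetric] flip: \<open>_ = ennreal (1 - t * s)\<close>)
qed simp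

lemma mixture_0: "sets Q = sets P \<Longrightarrow> mixture P Q 0 = P"
  by (rule measure_eqI) (simp_all add: emeasure_mixture)

lemma mixture_1: "sets Q = sets P \<Longrightarrow> mixture P Q 1 = Q"
  by (rule measure_eqI) (simp_all add: emeasure_mixture)

lemma mixture_self: "t \<in> {0..1} \<Longrightarrow> mixture P P t = P"
  by (rule measure_eqI) (simp_all add: emeasure_mixture flip: distrib_right ennreal_plus)

text \<open>The defining formula of the integral operator along the segment from \<open>P\<close> to \<open>Q\<close>.\<close>

lemma Psi_mixture:
  assumes sets: "sets Q = sets P" and t: "t \<in> {0..1}"
    and int: "integrable_unit (\<lambda>s. ennreal (1 / s) * D P (mixture P Q s))"
    and D0: "D P P = 0"
  shows "Psi D P (mixture P Q t)
    = (\<integral>\<^sup>+s. ennreal (1 / s) * D P (mixture P Q s) \<partial>lebesgue_on {0..t})"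
proof (cases "t = 0")
  case True
  have "Psi D P (mixture P Q t) = (\<integral>\<^sup>+s. 0 \<partial>lebesgue_on {0..1::real})"
    unfolding Psi_def
    by (intro nn_integral_cong) (simp add: True D0 mixture_self mixture_0 sets)
  moreover have "(\<integral>\<^sup>+s. ennreal (1 / s) * D P (mixture P Q s) \<partial>lebesgue_on {0..t})
      = (\<integral>\<^sup>+s. 0 \<partial>lebesgue_on {0..t})"
    by (intro nn_integral_cong) (simp add: True mixture_0 sets)
  ultimately show ?thesis by simp
next
  case False
  with t have t: "0 < t" "t \<le> 1" by auto
  define f where "f s = ennreal (1 / s) * D P (mixture P Q s) * indicator {0..t} s" for s
  have "(\<lambda>s. ennreal (1 / s) * D P (mixture P Q s)) \<in> borel_measurable (lebesgue_on {0..1})"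
    using int by (simp add: integrable_unit_def)
  then have "(\<lambda>s. ennreal (1 / s) * D P (mixture P Q s) * indicator {0..1} s)
      \<in> borel_measurable lebesgue"
    by (simp add: borel_measurable_restrict_space_iff_ennreal)
  then have "(\<lambda>s. ennreal (1 / s) * D P (mixture P Q s) * indicator {0..1} s * indicator {0..t} s)
      \<in> borel_measurable lebesgue"
    by (rule borel_measurable_times_ennreal) (rule borel_measurable_indicator, simp)
  also have "(\<lambda>s. ennreal (1 / s) * D P (mixture P Q s) * indicator {0..1} s * indicator {0..t} s)
      = f"
    using t by (auto simp: f_def fun_eq_iff indicator_def)
  finally have f [measurable]: "f \<in> borel_measurable lebesgue" .
  have T: "(\<lambda>x. t * x) \<in> lebesgue \<rightarrow>\<^sub>M lebesgue"
    using lebesgue_measurable_scaling [where 'a = real, of t] by (simp add: real_scaleR_def [abs_def])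
  have "(\<integral>\<^sup>+s. ennreal (1 / s) * D P (mixture P Q s) \<partial>lebesgue_on {0..t})
      = (\<integral>\<^sup>+s. f s \<partial>lebesgue)"
    by (simp add: nn_integral_restrict_space f_def)
  also have "\<dots> = (\<integral>\<^sup>+s. f s \<partial>density (distr lebesgue lebesgue (\<lambda>x. t * x)) (\<lambda>_. ennreal \<bar>t\<bar>))"
    using t lebesgue_real_scale [of t] by simp
  also have "\<dots> = (\<integral>\<^sup>+s. ennreal \<bar>t\<bar> * f s \<partial>distr lebesgue lebesgue (\<lambda>x. t * x))"
    by (subst nn_integral_density) auto
  also have "\<dots> = (\<integral>\<^sup>+s. ennreal \<bar>t\<bar> * f (t * s) \<partial>lebesgue)"
    by (subst nn_integral_distr [OF T]) auto
  also have "\<dots> = (\<integral>\<^sup>+s. ennreal (1 / s) * D P (mixture P (mixture P Q t) s)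
      * indicator {0..1} s \<partial>lebesgue)"
  proof (intro nn_integral_cong)
    fix s :: real
    show "ennreal \<bar>t\<bar> * f (t * s)
      = ennreal (1 / s) * D P (mixture P (mixture P Q t) s) * indicator {0..1} s"
    proof (cases "s \<in> {0..1}")
      case True
      then have "ennreal t * ennreal (1 / (t * s)) = ennreal (1 / s)"
        using t by (cases "s = 0") (simp_all flip: ennreal_mult)
      moreover have "t * s \<in> {0..t}" using True t by (auto simp: mult_left_le)
      ultimately show ?thesis
        using True t mixture_mixture [OF sets True, of t]
        by (simp add: f_def mult.assoc [symmetric])
    next
      case False
      then have "t * s \<notin> {0..t}" using t by (auto simp: zero_le_mult_iff)
      then show ?thesis using False by (simp add: f_def)
    qed
  qed
  also have "\<dots> = Psi D P (mixture P Q t)"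
    by (simp add: Psi_def nn_integral_restrict_space)
  finally show ?thesis by simp
qed

end

theory Submission
  imports Defs
begin

text \<open>
  A right-convex divergence \<open>E\<close> vanishes at the starting point of the segment from \<open>P\<close> to \<open>Q\<close>, so
  convexity puts it below its chord: \<open>E P (mixture P Q s) \<le> s * E P Q\<close>
  (\<open>right_convex_divergence_chord\<close>). This single inequality is used twice.

  For \<open>D\<close> itself it bounds the integrand \<open>D P (mixture P Q s) / s\<close> of \<^term>\<open>Psi D P Q\<close> by the
  constant \<^term>\<open>D P Q\<close>, which gives \<open>Psi D \<le> D\<close> on integrating over the unit interval.

  The integrand is positive for \<open>s > 0\<close> as soon as \<open>P \<noteq> Q\<close>, which makes \<^term>\<open>Psi D\<close> a divergence.
  It is right-convex because the mixture with weight \<open>s\<close> towards a mixture of \<open>Q2\<close> and \<open>Q1\<close> is a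
  mixture of the two mixtures (\<open>mixture_interchange\<close>), so that convexity holds under the integral
  sign. Hence the chord inequality also applies to \<^term>\<open>Psi D\<close>. Since moreover \<^term>\<open>Psi D\<close> is
  finite, by the assumed integrability, and positive off the diagonal, shrinking the segment by a
  factor \<open>r < 1\<close> strictly decreases \<^term>\<open>Psi D\<close>: this is strict monotonicity along the segment.
  Monotonicity provides the measurability of \<open>t \<mapsto> Psi D P (mixture P Q t) / t\<close>, and
  \<open>Psi D \<le> D\<close> bounds its integral.
\<close>

section \<open>Mixtures\<close>

lemma distributions_sets_eq:
  "P \<in> distributions N \<Longrightarrow> Q \<in> distributions N \<Longrightarrow> sets Q = sets P"
  by (simp add: distributions_def)

lemma mixture_interchange:
  assumes sets: "sets Q1 = sets P" "sets Q2 = sets P" and l: "l \<in> {0..1}"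
  shows "mixture P (mixture Q2 Q1 l) s = mixture (mixture P Q2 s) (mixture P Q1 s) l"
proof (rule measure_eqI)
  fix A
  have "ennreal (1 - l) + ennreal l = 1"
    using l by (simp flip: ennreal_plus)
  then have "ennreal (1 - l) * x + ennreal l * x = x" for x :: ennreal
    by (simp flip: distrib_right)
  from this[of "ennreal (1 - s) * emeasure P A"]
  show "emeasure (mixture P (mixture Q2 Q1 l) s) A
      = emeasure (mixture (mixture P Q2 s) (mixture P Q1 s) l) A"
    using sets by (simp add: emeasure_mixture distrib_left ac_simps)
qed simp

text \<open>
  On each event the equation reads \<open>(1 - s) p + s q = p\<close> with real \<open>p\<close> and \<open>q\<close>, both measures being
  finite, so \<open>s\<close> can be cancelled.
\<close>

lemma mixture_eq_start_iff:
  assumes P: "P \<in> distributions N" and Q: "Q \<in> distributions N" and s: "0 < s" "s \<le> 1"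
  shows "mixture P Q s = P \<longleftrightarrow> P = Q"
proof
  assume eq: "mixture P Q s = P"
  interpret P: prob_space P using P by (simp add: distributions_def)
  interpret Q: prob_space Q using Q by (simp add: distributions_def)
  have sets: "sets Q = sets P" using P Q by (rule distributions_sets_eq)
  show "P = Q"
  proof (rule measure_eqI)
    fix A
    have "ennreal ((1 - s) * measure P A + s * measure Q A) = ennreal (measure P A)"
      using emeasure_mixture[OF sets, of s A] s
      by (simp add: eq P.emeasure_eq_measure Q.emeasure_eq_measure ennreal_mult)
    then have "(1 - s) * measure P A + s * measure Q A = measure P A"
      using s by (subst (asm) ennreal_inj) auto
    then have "measure P A = measure Q A"
      using s by (simp add: algebra_simps)
    then show "emeasure P A = emeasure Q A"
      by (simp add: P.emeasure_eq_measure Q.emeasure_eq_measure)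
  qed (simp add: sets)
qed (use s in \<open>simp add: mixture_self\<close>)

section \<open>The chord inequality\<close>

text \<open>
  Right-convexity between \<open>Q\<close>, with weight \<open>s\<close>, and \<open>P\<close>, where the divergence is zero.
\<close>

lemma right_convex_divergence_chord:
  assumes E: "divergence (distributions N) E" "right_convex (distributions N) E"
    and P: "P \<in> distributions N" and Q: "Q \<in> distributions N" and s: "s \<in> {0..1}"
  shows "E P (mixture P Q s) \<le> ennreal s * E P Q"
proof -
  have "E P (mixture P Q s) \<le> ennreal s * E P Q + ennreal (1 - s) * E P P"
    using E(2) P Q s unfolding right_convex_def by blast
  moreover have "E P P = 0"
    using E(1) P by (simp add: divergence_def)
  ultimately show ?thesis by simp
qed

lemma Psi_le:
  assumes D: "divergence (distributions N) D" "right_convex (distributions N) D"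
    and P: "P \<in> distributions N" and Q: "Q \<in> distributions N"
  shows "Psi D P Q \<le> D P Q"
proof -
  have "Psi D P Q \<le> (\<integral>\<^sup>+s. D P Q \<partial>lebesgue_on {0..1::real})"
    unfolding Psi_def
  proof (rule nn_integral_mono)
    fix s :: real
    assume "s \<in> space (lebesgue_on {0..1})"
    then have s: "s \<in> {0..1}" by simp
    show "ennreal (1 / s) * D P (mixture P Q s) \<le> D P Q"
      \<comment> \<open>At \<open>s = 0\<close> the integrand is zero, since \<open>1 / 0 = 0\<close>.\<close>
    proof (cases "s = 0")
      case False
      then have "ennreal (1 / s) * ennreal s = 1"
        using s by (simp flip: ennreal_mult)
      then show ?thesis
        using mult_left_mono[OF right_convex_divergence_chord[OF D P Q s], of "ennreal (1 / s)"]
        by (simp flip: mult.assoc)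
    qed simp
  qed
  also have "\<dots> = D P Q"
    by (simp add: emeasure_restrict_space)
  finally show ?thesis .
qed

section \<open>The integral operator preserves right-convex divergences\<close>

text \<open>
  If the integral vanishes, the measurable integrand vanishes almost everywhere, hence at some
  \<open>s > 0\<close>; there \<open>D P (mixture P Q s) = 0\<close>, so that the mixture has not left \<open>P\<close>.
\<close>

lemma divergence_Psi:
  assumes D: "divergence (distributions N) D"
    and meas: "\<And>P Q. P \<in> distributions N \<Longrightarrow> Q \<in> distributions N \<Longrightarrow>
      (\<lambda>s. ennreal (1 / s) * D P (mixture P Q s)) \<in> borel_measurable (lebesgue_on {0..1})"
  shows "divergence (distributions N) (Psi D)"
proof -
  have "Psi D P Q = 0 \<longleftrightarrow> P = Q" if P: "P \<in> distributions N" and Q: "Q \<in> distributions N" for P Q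
  proof
    assume "P = Q"
    moreover have "D P P = 0" using D P by (simp add: divergence_def)
    moreover have "Psi D P P = (\<integral>\<^sup>+s. 0 \<partial>lebesgue_on {0..1::real})"
      unfolding Psi_def using \<open>D P P = 0\<close>
      by (intro nn_integral_cong) (simp add: mixture_self)
    ultimately show "Psi D P Q = 0" by simp
  next
    assume "Psi D P Q = 0"
    then have "AE s in lebesgue_on {0..1}. ennreal (1 / s) * D P (mixture P Q s) = 0"
      using meas[OF P Q] by (simp add: Psi_def nn_integral_0_iff_AE)
    then have ae: "AE s in lebesgue. s \<in> {0..1} \<longrightarrow> ennreal (1 / s) * D P (mixture P Q s) = 0"
      by (simp add: AE_restrict_space_iff)
    have "\<exists>s\<in>{0<..1}. ennreal (1 / s) * D P (mixture P Q s) = 0"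
    proof (rule ccontr)
      assume neg: "\<not> ?thesis"
      have "AE s in lebesgue. s \<notin> {0<..1::real}"
        using ae by eventually_elim (use neg in auto)
      then have "{0<..1::real} \<in> null_sets lebesgue"
        by (subst AE_iff_null_sets) auto
      then show False by (simp add: null_sets_def)
    qed
    then obtain s where s: "0 < s" "s \<le> 1" and "D P (mixture P Q s) = 0"
      by (auto simp: ennreal_eq_0_iff)
    moreover have "mixture P Q s \<in> distributions N"
      using mixture_in_distributions[OF P Q] s by simp
    ultimately have "mixture P Q s = P"
      using D P by (auto simp: divergence_def)
    then show "P = Q" using mixture_eq_start_iff[OF P Q s] by simp
  qed
  then show ?thesis by (simp add: divergence_def)
qed

text \<open>
  The inequality holds pointwise in \<open>s\<close>, by convexity of \<open>D\<close> between \<open>mixture P Q1 s\<close> and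
  \<open>mixture P Q2 s\<close>. Measurability is needed to split the integral of the upper bound.
\<close>

lemma right_convex_Psi:
  assumes D: "right_convex (distributions N) D"
    and meas: "\<And>P Q. P \<in> distributions N \<Longrightarrow> Q \<in> distributions N \<Longrightarrow>
      (\<lambda>s. ennreal (1 / s) * D P (mixture P Q s)) \<in> borel_measurable (lebesgue_on {0..1})"
  shows "right_convex (distributions N) (Psi D)"
  unfolding right_convex_def
proof (intro ballI)
  fix P Q1 Q2 :: "'a measure" and l :: real
  assume P: "P \<in> distributions N" and Q: "Q1 \<in> distributions N" "Q2 \<in> distributions N"
    and l: "l \<in> {0..1}"
  let ?f = "\<lambda>Q s. ennreal (1 / s) * D P (mixture P Q s)"
  note [measurable] = meas[OF P Q(1)] meas[OF P Q(2)]
  have "Psi D P (mixture Q2 Q1 l)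
      \<le> (\<integral>\<^sup>+s. ennreal l * ?f Q1 s + ennreal (1 - l) * ?f Q2 s \<partial>lebesgue_on {0..1})"
    unfolding Psi_def
  proof (rule nn_integral_mono)
    fix s :: real
    assume "s \<in> space (lebesgue_on {0..1})"
    then have s: "s \<in> {0..1}" by simp
    have "D P (mixture P (mixture Q2 Q1 l) s)
        = D P (mixture (mixture P Q2 s) (mixture P Q1 s) l)"
      using mixture_interchange[OF distributions_sets_eq distributions_sets_eq l] P Q by metis
    also have "\<dots> \<le> ennreal l * D P (mixture P Q1 s) + ennreal (1 - l) * D P (mixture P Q2 s)"
      using D P l mixture_in_distributions[OF P _ s] Q unfolding right_convex_def by blast
    finally have "ennreal (1 / s) * D P (mixture P (mixture Q2 Q1 l) s)
        \<le> ennreal (1 / s) *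
          (ennreal l * D P (mixture P Q1 s) + ennreal (1 - l) * D P (mixture P Q2 s))"
      by (rule mult_left_mono) simp
    then show "ennreal (1 / s) * D P (mixture P (mixture Q2 Q1 l) s)
        \<le> ennreal l * ?f Q1 s + ennreal (1 - l) * ?f Q2 s"
      by (simp add: distrib_left mult.left_commute)
  qed
  also have "\<dots> = ennreal l * Psi D P Q1 + ennreal (1 - l) * Psi D P Q2"
    unfolding Psi_def by (subst nn_integral_add) (simp_all add: nn_integral_cmult)
  finally show "Psi D P (mixture Q2 Q1 l)
      \<le> ennreal l * Psi D P Q1 + ennreal (1 - l) * Psi D P Q2" .
qed

section \<open>Behaviour along a segment\<close>

text \<open>
  For \<open>t < u\<close> the point at \<open>t\<close> divides the segment from \<open>P\<close> to the point at \<open>u\<close> in the ratio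
  \<open>t / u < 1\<close>, so by the chord inequality the value at \<open>t\<close> is at most \<open>t / u\<close> times the value at \<open>u\<close>.
  Finiteness and positivity of the latter make this a strict decrease.
\<close>

lemma right_convex_divergence_strict_mono:
  assumes E: "divergence (distributions N) E" "right_convex (distributions N) E"
    and P: "P \<in> distributions N" and Q: "Q \<in> distributions N" and "P \<noteq> Q"
    and finite: "\<And>t. t \<in> {0..1} \<Longrightarrow> E P (mixture P Q t) < \<infinity>"
  shows "strict_mono_on {0..1} (\<lambda>t. E P (mixture P Q t))"
proof (rule strict_mono_onI)
  fix t u :: real
  assume tu: "t \<in> {0..1}" "u \<in> {0..1}" "t < u"
  define R where "R = mixture P Q u"
  have R: "R \<in> distributions N"
    unfolding R_def using P Q tu(2) by (rule mixture_in_distributions)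
  have ratio: "t / u \<in> {0..1}" using tu by auto
  have "R \<noteq> P"
    using mixture_eq_start_iff[OF P Q, of u] tu \<open>P \<noteq> Q\<close> by (auto simp: R_def)
  then have pos: "E P R \<noteq> 0"
    using E(1) P R by (auto simp: divergence_def)
  have "mixture P Q t = mixture P R (t / u)"
    using mixture_mixture[OF distributions_sets_eq[OF P Q] ratio tu(2)] tu by (simp add: R_def)
  then have "E P (mixture P Q t) \<le> ennreal (t / u) * E P R"
    using right_convex_divergence_chord[OF E P R ratio] by simp
  also have "\<dots> < 1 * E P R"
    using pos finite[OF tu(2)] tu
    by (intro ennreal_mult_strict_right_mono) (auto simp: R_def less_top zero_less_iff_neq_zero)
  finally show "E P (mixture P Q t) < E P (mixture P Q u)"
    by (simp add: R_def)
qed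

text \<open>
  Finiteness allows the passage to the real-valued function \<open>enn2real \<circ> f\<close>, which is monotone and
  therefore Borel, and back.
\<close>

lemma borel_measurable_mono_on_ennreal:
  fixes f :: "real \<Rightarrow> ennreal"
  assumes mono: "mono_on A f" and finite: "\<And>t. t \<in> A \<Longrightarrow> f t < \<infinity>"
  shows "f \<in> borel_measurable (lebesgue_on A)"
proof -
  have "mono_on A (\<lambda>t. enn2real (f t))"
    using mono finite by (auto simp: mono_on_def intro!: enn2real_mono)
  then have "(\<lambda>t. enn2real (f t)) \<in> borel_measurable (restrict_space borel A)"
    by (rule borel_measurable_mono_on_fnc)
  then have "(\<lambda>t. enn2real (f t)) \<in> borel_measurable (lebesgue_on A)"
    by (auto simp: measurable_def space_restrict_space sets_restrict_space)
  then have "(\<lambda>t. ennreal (enn2real (f t))) \<in> borel_measurable (lebesgue_on A)"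
    by measurable
  then show ?thesis
    by (rule measurable_cong[THEN iffD1, rotated]) (use finite in simp)
qed

theorem theorem1:
  fixes N :: "'a measure" and D :: "'a measure \<Rightarrow> 'a measure \<Rightarrow> ennreal"
  assumes "divergence (distributions N) D"
    and "right_convex (distributions N) D"
    and "\<And>P Q. P \<in> distributions N \<Longrightarrow> Q \<in> distributions N \<Longrightarrow>
      integrable_unit (\<lambda>t. ennreal (1 / t) * D P (mixture P Q t))"
  shows "divergence (distributions N) (Psi D) \<and>
    right_convex (distributions N) (Psi D) \<and>
    (\<forall>P\<in>distributions N. \<forall>Q\<in>distributions N.
      (\<forall>t\<in>{0..1}. D P (mixture P Q t) \<ge> Psi D P (mixture P Q t) \<and>
        Psi D P (mixture P Q t) \<ge> 0) \<and>
      (P \<noteq> Q \<longrightarrow> strict_mono_on {0..1} (\<lambda>t. Psi D P (mixture P Q t))) \<and>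
      integrable_unit (\<lambda>t. ennreal (1 / t) * Psi D P (mixture P Q t)))"
proof -
  have meas: "(\<lambda>s. ennreal (1 / s) * D P (mixture P Q s)) \<in> borel_measurable (lebesgue_on {0..1})"
    and finite: "Psi D P Q < \<infinity>"
    if "P \<in> distributions N" "Q \<in> distributions N" for P Q
    using assms(3)[OF that] by (simp_all add: integrable_unit_def Psi_def)
  have div: "divergence (distributions N) (Psi D)"
    using assms(1) meas by (rule divergence_Psi)
  have conv: "right_convex (distributions N) (Psi D)"
    using assms(2) meas by (rule right_convex_Psi)
  have strict: "strict_mono_on {0..1} (\<lambda>t. Psi D P (mixture P Q t))"
    if "P \<in> distributions N" "Q \<in> distributions N" "P \<noteq> Q" for P Q
    using div conv that finite[OF that(1) mixture_in_distributions[OF that(1,2)]]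
    by (rule right_convex_divergence_strict_mono)
  have le: "Psi D P (mixture P Q t) \<le> D P (mixture P Q t)"
    if "P \<in> distributions N" "Q \<in> distributions N" "t \<in> {0..1}" for P Q t
    using assms(1,2) that(1) mixture_in_distributions[OF that] by (rule Psi_le)
  have "integrable_unit (\<lambda>t. ennreal (1 / t) * Psi D P (mixture P Q t))"
    if P: "P \<in> distributions N" and Q: "Q \<in> distributions N" for P Q
  proof -
    have "mono_on {0..1} (\<lambda>t. Psi D P (mixture P Q t))"
    proof (cases "P = Q")
      case True
      then show ?thesis by (auto simp: mono_on_def mixture_self)
    qed (use strict[OF P Q] in \<open>simp add: strict_mono_on_imp_mono_on\<close>)
    then have "(\<lambda>t. Psi D P (mixture P Q t)) \<in> borel_measurable (lebesgue_on {0..1})"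
      using finite[OF P mixture_in_distributions[OF P Q]]
      by (rule borel_measurable_mono_on_ennreal)
    moreover have "(\<lambda>t. ennreal (1 / t)) \<in> borel_measurable (lebesgue_on {0..1})"
      by (intro measurable_restrict_space1 measurable_completion) simp
    ultimately have "(\<lambda>t. ennreal (1 / t) * Psi D P (mixture P Q t))
        \<in> borel_measurable (lebesgue_on {0..1})"
      by (intro borel_measurable_times_ennreal)
    moreover have "(\<integral>\<^sup>+t. ennreal (1 / t) * Psi D P (mixture P Q t) \<partial>lebesgue_on {0..1}) \<le> Psi D P Q"
      unfolding Psi_def[of D P Q]
      using le[OF P Q] by (intro nn_integral_mono mult_left_mono) auto
    ultimately show ?thesis
      using finite[OF P Q] by (auto simp: integrable_unit_def intro: le_less_trans)
  qed
  then show ?thesis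
    using div conv strict le by simp
qed

end
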